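(* Let $0<d<1$ and $P=d\,P_s$, where $P_s$ is an $N\times N$ transition matrix (non-negative entries, each column summing to $1$), and let $B\in\mathbb{R}^N$. For each $i$ let $out_i$ be the number of non-zero entries of the $i$-th column of $P$, and let $L=\sum_{i=1}^N out_i$. Consider the D-iteration for $(P,B)$ with the sequence chosen by the rule (COST) $i_n=\arg\max_i\big((F_{n-1})_i/out_i\big)$. Then the convergence speed of COST is at least $d^{\lfloor l/L\rfloor}$, where $l$ is the number of times a non-zero element of $P$ is used; that is, for all $n\ge0$, with $l=\sum_{k=1}^n out_{i_k}$, $$|F_n|\le d^{\lfloor l/L\rfloor}\,|F_0| .$$
   Context: For $X\in\mathbb{R}^N$, $|X|=\sum_{i=1}^N|x_i|$. Let $I$ be the $N\times N$ identity matrix and $J_i$ the matrix whose only non-zero entry is $(J_i)_{ii}=1$. The diffusion operators of $P$ are $P_i=I-J_i+PJ_i$. The D-iteration for $(P,B)$ and a sequence $\{i_1,i_2,\dots\}$ in $\{1,\dots,N\}$ is $F_0=B$, $H_0=0$ and, for $n\ge1$, $F_n=P_{i_n}F_{n-1}$, $H_n=H_{n-1}+J_{i_n}F_{n-1}$. The vector $F_n$ is the residual fluid, whose $L_1$-norm measures convergence. Diffusing node $i$ uses each of the $out_i$ non-zero elements of column $i$ of $P$ once.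
   Formalization: For signed B the literal COST rule fails (N=2, all entries of P_s equal 1/2, B=(-1,0): F never changes), so the claim is proved for B ≥ 0 with the literal rule, and for arbitrary B with the rule i_n = argmax |(F_{n-1})_i|/out_i. *)

theory Defs
  imports "HOL-Analysis.Analysis"
begin

definition l1_norm :: "real ^ 'n \<Rightarrow> real" where
  "l1_norm X = (\<Sum>i\<in>UNIV. \<bar>X $ i\<bar>)"

text \<open>The entry of a matrix \<open>P\<close> in row \<open>j\<close> and column \<open>i\<close> is \<open>P $ j $ i\<close>; transition
  matrices are column-stochastic.\<close>

definition transition_matrix :: "real ^ 'n ^ 'n \<Rightarrow> bool" where
  "transition_matrix P \<longleftrightarrow> (\<forall>j i. 0 \<le> P $ j $ i) \<and> (\<forall>i. (\<Sum>j\<in>UNIV. P $ j $ i) = 1)"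

definition unit_matrix :: "'n \<Rightarrow> real ^ 'n ^ 'n" where
  "unit_matrix i = (\<chi> a b. if a = i \<and> b = i then 1 else 0)"

definition diffusion_op :: "real ^ 'n ^ 'n \<Rightarrow> 'n \<Rightarrow> real ^ 'n ^ 'n" where
  "diffusion_op P i = mat 1 - unit_matrix i + P ** unit_matrix i"

text \<open>Node sequences are indexed from \<open>1\<close>: the value \<open>s 0\<close> is never used.\<close>

primrec residual_fluid :: "real ^ 'n ^ 'n \<Rightarrow> real ^ 'n \<Rightarrow> (nat \<Rightarrow> 'n) \<Rightarrow> nat \<Rightarrow> real ^ 'n" where
  "residual_fluid P B s 0 = B"
| "residual_fluid P B s (Suc n) = diffusion_op P (s (Suc n)) *v residual_fluid P B s n"

primrec history_fluid :: "real ^ 'n ^ 'n \<Rightarrow> real ^ 'n \<Rightarrow> (nat \<Rightarrow> 'n) \<Rightarrow> nat \<Rightarrow> real ^ 'n" where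
  "history_fluid P B s 0 = 0"
| "history_fluid P B s (Suc n) =
     history_fluid P B s n + unit_matrix (s (Suc n)) *v residual_fluid P B s n"

definition out_degree :: "real ^ 'n ^ 'n \<Rightarrow> 'n \<Rightarrow> nat" where
  "out_degree P i = card {j. P $ j $ i \<noteq> 0}"

definition num_links :: "real ^ 'n ^ 'n \<Rightarrow> nat" where
  "num_links P = (\<Sum>i\<in>UNIV. out_degree P i)"

definition links_used :: "real ^ 'n ^ 'n \<Rightarrow> (nat \<Rightarrow> 'n) \<Rightarrow> nat \<Rightarrow> nat" where
  "links_used P s n = (\<Sum>k=1..n. out_degree P (s k))"

text \<open>Ties in the arg max may be broken arbitrarily.\<close>

definition cost_sequence :: "real ^ 'n ^ 'n \<Rightarrow> real ^ 'n \<Rightarrow> (nat \<Rightarrow> 'n) \<Rightarrow> bool" where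
  "cost_sequence P B s \<longleftrightarrow>
     (\<forall>n\<ge>1. is_arg_max (\<lambda>i. residual_fluid P B s (n - 1) $ i / real (out_degree P i))
               (\<lambda>_. True) (s n))"

text \<open>The same rule with the amount of fluid at a node measured by its absolute value. The two
  rules agree when \<open>P\<close> and \<open>B\<close> are non-negative, since the residual fluid is then
  non-negative. For a signed \<open>B\<close> only this one makes progress: if every entry of \<open>P\<close> is
  \<open>d / 2\<close> on two nodes and \<open>B = (- 1, 0)\<close>, then \<^const>\<open>cost_sequence\<close> selects the second
  node, which carries no fluid, at every step, and the residual fluid remains \<open>B\<close>.\<close>

definition abs_cost_sequence :: "real ^ 'n ^ 'n \<Rightarrow> real ^ 'n \<Rightarrow> (nat \<Rightarrow> 'n) \<Rightarrow> bool" where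
  "abs_cost_sequence P B s \<longleftrightarrow>
     (\<forall>n\<ge>1. is_arg_max (\<lambda>i. \<bar>residual_fluid P B s (n - 1) $ i\<bar> / real (out_degree P i))
               (\<lambda>_. True) (s n))"

end

theory Submission
  imports Defs
begin

text \<open>
  The greedy rule is analysed by amortisation. Imagine that during one round of \<open>L\<close> link uses
  every node \<open>j\<close> must diffuse, once, the fluid it carries; using a link of \<open>j\<close> pays for one of the
  \<open>out\<^sub>j\<close> shares of that duty. Let \<open>w\<^sub>j \<in> [0, 1]\<close> be the fraction of the duty of \<open>j\<close> still open, so
  that the \<open>\<Sum>\<^sub>j w\<^sub>j out\<^sub>j\<close> open shares are exactly the link uses left in the round. Open duties
  promise that their fluid will still be multiplied by \<open>d\<close>, which makes
  \<open>\<Phi>\<^sub>w(F) = \<Sum>\<^sub>j (1 - (1 - d) w\<^sub>j) \<bar>F\<^sub>j\<bar>\<close>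
  an estimate of the mass at the end of the round. It is \<open>d \<bar>F\<bar>\<close> when all duties are open, \<open>\<bar>F\<bar>\<close> when
  none is, and never below \<open>d \<bar>F\<bar>\<close>.

  Diffusing node \<open>i\<close> moves \<open>a = \<bar>F\<^sub>i\<bar> / out\<^sub>i\<close> per link, and \<open>a\<close> is the largest such rate over all
  nodes. Hence its \<open>out\<^sub>i\<close> link uses can close the open shares of \<open>i\<close> and then foreign ones
  without increasing \<open>\<Phi>\<close> (lemma \<open>step_within_round\<close>). A step need not end where a round ends. If it crosses
  the end of the round, its first link uses close all open shares, and the remaining ones
  close part of the duty of \<open>i\<close> for the next round; this shrinks \<open>\<Phi>\<close> by the factor \<open>d\<close>
  (lemma \<open>step_across_rounds\<close>). So \<open>\<Phi>\<^sub>w(F\<^sub>n) \<le> d^(q + 1) \<bar>F\<^sub>0\<bar>\<close> holds after \<open>q\<close> complete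
  rounds for suitable \<open>w\<close>, and \<open>d \<bar>F\<^sub>n\<bar> \<le> \<Phi>\<^sub>w(F\<^sub>n)\<close> gives the bound.

  Signs of the fluid matter only through the triangle inequality: the coefficients of \<open>\<Phi>\<close> are
  non-negative, so fluids of opposite sign meeting at a node can only decrease it.
\<close>

section \<open>Diffusion of one node\<close>

lemma diffusion_op_component:
  fixes P :: "real ^ 'n ^ 'n"
  shows "(diffusion_op P i *v F) $ j = (if j = i then 0 else F $ j) + P $ j $ i * F $ i"
proof -
  have unit: "unit_matrix i *v F = (\<chi> k. if k = i then F $ i else 0)"
    by (simp add: unit_matrix_def matrix_vector_mult_def vec_eq_iff if_distrib if_distribR
        cong: if_cong)
  have "diffusion_op P i *v F = F - unit_matrix i *v F + P *v (unit_matrix i *v F)"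
    by (simp add: diffusion_op_def matrix_vector_mult_add_rdistrib
        matrix_vector_mult_diff_rdistrib matrix_vector_mul_assoc)
  then show ?thesis
    by (simp add: unit) (simp add: matrix_vector_mult_def if_distrib cong: if_cong)
qed

lemma weighted_mass_after_diffusion:
  fixes P :: "real ^ 'n ^ 'n" and v :: "'n \<Rightarrow> real"
  assumes P: "\<And>j. 0 \<le> P $ j $ i" and v: "\<And>j. 0 \<le> v j"
  shows "(\<Sum>j\<in>UNIV. v j * \<bar>(diffusion_op P i *v F) $ j\<bar>)
    \<le> (\<Sum>j\<in>UNIV. v j * \<bar>F $ j\<bar>) - v i * \<bar>F $ i\<bar> + (\<Sum>j\<in>UNIV. v j * P $ j $ i) * \<bar>F $ i\<bar>"
proof -
  have "(\<Sum>j\<in>UNIV. v j * \<bar>(diffusion_op P i *v F) $ j\<bar>)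
      \<le> (\<Sum>j\<in>UNIV. v j * \<bar>F $ j\<bar> - (if j = i then v i * \<bar>F $ i\<bar> else 0)
           + v j * P $ j $ i * \<bar>F $ i\<bar>)"
  proof (rule sum_mono)
    fix j
    have "\<bar>(diffusion_op P i *v F) $ j\<bar> \<le> (if j = i then 0 else \<bar>F $ j\<bar>) + P $ j $ i * \<bar>F $ i\<bar>"
      using P[of j] abs_triangle_ineq[of "F $ j" "P $ j $ i * F $ i"]
      by (auto simp: diffusion_op_component abs_mult)
    from mult_left_mono[OF this v[of j]]
    show "v j * \<bar>(diffusion_op P i *v F) $ j\<bar>
      \<le> v j * \<bar>F $ j\<bar> - (if j = i then v i * \<bar>F $ i\<bar> else 0) + v j * P $ j $ i * \<bar>F $ i\<bar>"
      by (auto simp: algebra_simps)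
  qed
  also have "\<dots> = (\<Sum>j\<in>UNIV. v j * \<bar>F $ j\<bar>) - v i * \<bar>F $ i\<bar> + (\<Sum>j\<in>UNIV. v j * P $ j $ i) * \<bar>F $ i\<bar>"
    by (simp add: sum.distrib sum_subtractf sum_distrib_right)
  finally show ?thesis .
qed

section \<open>The amortised mass\<close>

definition amortised_mass :: "real \<Rightarrow> ('n \<Rightarrow> real) \<Rightarrow> real ^ 'n \<Rightarrow> real" where
  "amortised_mass d w F = (\<Sum>j\<in>UNIV. (1 - (1 - d) * w j) * \<bar>F $ j\<bar>)"

lemma amortised_mass_eq:
  "amortised_mass d w F = l1_norm F - (1 - d) * (\<Sum>j\<in>UNIV. w j * \<bar>F $ j\<bar>)"
  by (simp add: amortised_mass_def l1_norm_def algebra_simps sum_subtractf sum.distrib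
      sum_distrib_left)

lemma l1_norm_le_amortised_mass:
  assumes "d \<le> 1" and "\<And>j. w j \<le> 1"
  shows "d * l1_norm F \<le> amortised_mass d w F"
proof -
  have "d * \<bar>F $ j\<bar> \<le> (1 - (1 - d) * w j) * \<bar>F $ j\<bar>" for j
    using mult_left_mono[OF assms(2)[of j], of "1 - d"] assms(1)
    by (intro mult_right_mono) auto
  then show ?thesis
    unfolding amortised_mass_def l1_norm_def sum_distrib_left by (intro sum_mono)
qed

text \<open>The next two lemmas follow one diffusion of a node \<open>i\<close> of maximal rate, where \<open>g j\<close> is the
  number of shares of node \<open>j\<close>. Shares are divisible, since \<open>w\<close> is real-valued; so the foreign
  ones can be closed in proportion, without choosing among the nodes.\<close>

lemma step_within_round:
  fixes P :: "real ^ 'n ^ 'n" and g w :: "'n \<Rightarrow> real"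
  assumes d: "0 < d" "d < 1"
    and P: "\<And>j. 0 \<le> P $ j $ i" "(\<Sum>j\<in>UNIV. P $ j $ i) = d"
    and g: "\<And>j. 0 < g j"
    and greedy: "\<And>j. \<bar>F $ j\<bar> / g j \<le> \<bar>F $ i\<bar> / g i"
    and w: "\<And>j. 0 \<le> w j" "\<And>j. w j \<le> 1"
    and room: "g i < (\<Sum>j\<in>UNIV. w j * g j)"
  obtains w' where "\<And>j. 0 \<le> w' j" "\<And>j. w' j \<le> 1"
    and "(\<Sum>j\<in>UNIV. w' j * g j) = (\<Sum>j\<in>UNIV. w j * g j) - g i"
    and "amortised_mass d w' (diffusion_op P i *v F) \<le> amortised_mass d w F"
proof -
  define R where "R = (\<Sum>j\<in>UNIV. w j * g j)"
  define a where "a = \<bar>F $ i\<bar> / g i"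
  \<comment> \<open>Node \<open>i\<close> first closes its own duty; the factor scales down the foreign ones so that
      exactly \<open>g i\<close> shares are closed altogether.\<close>
  define c where "c = (R - g i) / (R - w i * g i)"
  define w' where "w' = (\<lambda>j. if j = i then 0 else c * w j)"
  have own: "w i * g i \<le> g i"
    using w(2)[of i] g[of i] by simp
  have pos: "0 < R - w i * g i"
    using own room by (simp add: R_def)
  have c: "0 \<le> c" "c \<le> 1"
    using own room pos by (auto simp: c_def R_def field_simps)
  have w'_le: "w' j \<le> w j" for j
    using w(1) c by (auto simp: w'_def mult_left_le_one_le)
  have w'_nonneg: "0 \<le> w' j" for j
    using w(1) c by (auto simp: w'_def)
  have "(\<Sum>j\<in>UNIV. w' j * g j) = (\<Sum>j\<in>UNIV. c * (w j * g j) - (if j = i then c * (w i * g i) else 0))"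
    by (intro sum.cong) (auto simp: w'_def)
  also have "\<dots> = c * (R - w i * g i)"
    by (simp add: sum_subtractf R_def algebra_simps sum_distrib_left)
  finally have shares: "(\<Sum>j\<in>UNIV. w' j * g j) = R - g i"
    using pos by (simp add: c_def)
  \<comment> \<open>The closed shares are paid for at rate \<open>a\<close>, the maximal fluid per share.\<close>
  have "(\<Sum>j\<in>UNIV. w j * \<bar>F $ j\<bar>) - (\<Sum>j\<in>UNIV. w' j * \<bar>F $ j\<bar>)
      = (\<Sum>j\<in>UNIV. (w j - w' j) * \<bar>F $ j\<bar>)"
    by (simp add: sum_subtractf algebra_simps)
  also have "\<dots> \<le> (\<Sum>j\<in>UNIV. (w j - w' j) * (a * g j))"
    using greedy g w'_le by (intro sum_mono mult_left_mono) (auto simp: a_def pos_divide_le_eq)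
  also have "\<dots> = a * (R - (\<Sum>j\<in>UNIV. w' j * g j))"
    by (simp add: R_def sum_subtractf algebra_simps sum_distrib_left)
  also have "\<dots> = \<bar>F $ i\<bar>"
    using g[of i] by (simp add: shares a_def)
  finally have "(1 - d) * ((\<Sum>j\<in>UNIV. w j * \<bar>F $ j\<bar>) - (\<Sum>j\<in>UNIV. w' j * \<bar>F $ j\<bar>))
      \<le> (1 - d) * \<bar>F $ i\<bar>"
    using d by (intro mult_left_mono) auto
  then have paid: "amortised_mass d w' F - (1 - d) * \<bar>F $ i\<bar> \<le> amortised_mass d w F"
    by (simp add: amortised_mass_eq algebra_simps)
  have v: "0 \<le> 1 - (1 - d) * w' j" "1 - (1 - d) * w' j \<le> 1" for j
    using d w'_nonneg[of j] w'_le[of j] w(2)[of j] mult_left_le_one_le[of "w' j" "1 - d"] by auto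
  have "(\<Sum>j\<in>UNIV. (1 - (1 - d) * w' j) * P $ j $ i) \<le> (\<Sum>j\<in>UNIV. P $ j $ i)"
    using v P(1) by (intro sum_mono mult_left_le_one_le) auto
  then have "(\<Sum>j\<in>UNIV. (1 - (1 - d) * w' j) * P $ j $ i) * \<bar>F $ i\<bar> \<le> d * \<bar>F $ i\<bar>"
    using P(2) by (intro mult_right_mono) auto
  then have "amortised_mass d w' (diffusion_op P i *v F) \<le> amortised_mass d w' F - (1 - d) * \<bar>F $ i\<bar>"
    using weighted_mass_after_diffusion[of P i "\<lambda>j. 1 - (1 - d) * w' j" F] P(1) v(1)
    by (simp add: amortised_mass_def w'_def algebra_simps)
  with paid have "amortised_mass d w' (diffusion_op P i *v F) \<le> amortised_mass d w F"
    by simp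
  moreover have "w' j \<le> 1" for j
    using w'_le[of j] w(2)[of j] by simp
  ultimately show thesis
    using that[of w'] w'_nonneg shares by (auto simp: R_def)
qed

text \<open>In the new round all duties are open except that of \<open>i\<close>, of which a fraction \<open>R / g i\<close> is
  left, \<open>R\<close> being the number of shares open before the step. Splitting the step at the end
  of the round is harmless because the fluid that \<open>i\<close> sends to itself, the only part of its new
  fluid, is at most \<open>d \<bar>F\<^sub>i\<bar>\<close>.\<close>

lemma step_across_rounds:
  fixes P :: "real ^ 'n ^ 'n" and g w :: "'n \<Rightarrow> real"
  assumes d: "0 < d" "d < 1"
    and P: "\<And>j. 0 \<le> P $ j $ i" "(\<Sum>j\<in>UNIV. P $ j $ i) = d"
    and g: "\<And>j. 0 < g j"
    and greedy: "\<And>j. \<bar>F $ j\<bar> / g j \<le> \<bar>F $ i\<bar> / g i"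
    and w: "\<And>j. 0 \<le> w j"
    and cross: "(\<Sum>j\<in>UNIV. w j * g j) \<le> g i"
  obtains w' where "\<And>j. 0 \<le> w' j" "\<And>j. w' j \<le> 1"
    and "(\<Sum>j\<in>UNIV. w' j * g j) = (\<Sum>j\<in>UNIV. g j) + (\<Sum>j\<in>UNIV. w j * g j) - g i"
    and "amortised_mass d w' (diffusion_op P i *v F) \<le> d * amortised_mass d w F"
proof -
  define R where "R = (\<Sum>j\<in>UNIV. w j * g j)"
  define t where "t = R / g i"
  define w' where "w' = (\<lambda>j. if j = i then t else 1)"
  have "0 \<le> R"
    unfolding R_def using w g by (intro sum_nonneg mult_nonneg_nonneg) (auto simp: less_imp_le)
  then have t: "0 \<le> t" "t \<le> 1"
    using g[of i] cross by (auto simp: t_def R_def)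
  have "(\<Sum>j\<in>UNIV. w' j * g j) = (\<Sum>j\<in>UNIV. g j - (if j = i then g i - R else 0))"
    using g[of i] by (intro sum.cong) (auto simp: w'_def t_def)
  then have shares: "(\<Sum>j\<in>UNIV. w' j * g j) = (\<Sum>j\<in>UNIV. g j) + R - g i"
    by (simp add: sum_subtractf)
  have "(\<Sum>j\<in>UNIV. w j * \<bar>F $ j\<bar>) \<le> (\<Sum>j\<in>UNIV. w j * (\<bar>F $ i\<bar> / g i * g j))"
    using greedy g w by (intro sum_mono mult_left_mono) (auto simp: pos_divide_le_eq)
  also have "\<dots> = \<bar>F $ i\<bar> / g i * R"
    unfolding R_def sum_distrib_left by (intro sum.cong) auto
  also have "\<dots> = t * \<bar>F $ i\<bar>"
    by (simp add: t_def)
  finally have "(1 - d) * (\<Sum>j\<in>UNIV. w j * \<bar>F $ j\<bar>) \<le> (1 - d) * (t * \<bar>F $ i\<bar>)"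
    using d by (intro mult_left_mono) auto
  then have closed: "l1_norm F - (1 - d) * t * \<bar>F $ i\<bar> \<le> amortised_mass d w F"
    by (simp add: amortised_mass_eq)
  define r where "r = (1 - d) * (1 - t)"
  have r: "0 \<le> r"
    using d t by (simp add: r_def)
  have v: "1 - (1 - d) * w' j = d + (if j = i then r else 0)" for j
    by (simp add: w'_def r_def algebra_simps)
  have v_sum: "(\<Sum>j\<in>UNIV. (1 - (1 - d) * w' j) * h j) = d * (\<Sum>j\<in>UNIV. h j) + r * h i" for h
  proof -
    have "(1 - (1 - d) * w' j) * h j = d * h j + (if j = i then r * h i else 0)" for j
      by (simp add: v distrib_right)
    then show ?thesis
      by (simp add: sum.distrib sum_distrib_left)
  qed
  have "P $ i $ i \<le> (\<Sum>j\<in>UNIV. P $ j $ i)"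
    using P(1) by (intro member_le_sum) auto
  then have "r * P $ i $ i * \<bar>F $ i\<bar> \<le> r * d * \<bar>F $ i\<bar>"
    using r P(2) by (intro mult_right_mono mult_left_mono) auto
  moreover have "amortised_mass d w' (diffusion_op P i *v F)
      \<le> d * l1_norm F + r * \<bar>F $ i\<bar> - (d + r) * \<bar>F $ i\<bar> + (d * d + r * P $ i $ i) * \<bar>F $ i\<bar>"
    using weighted_mass_after_diffusion[of P i "\<lambda>j. 1 - (1 - d) * w' j" F] P(1) d r
    unfolding amortised_mass_def v_sum P(2) by (simp add: v l1_norm_def)
  ultimately have "amortised_mass d w' (diffusion_op P i *v F)
      \<le> d * (l1_norm F - (1 - d) * t * \<bar>F $ i\<bar>)"
    by (simp add: r_def algebra_simps)
  also have "\<dots> \<le> d * amortised_mass d w F"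
    using closed d by (intro mult_left_mono) auto
  finally show thesis
    using that[of w'] t shares by (auto simp: w'_def R_def)
qed

section \<open>Counting rounds\<close>

lemma abs_cost_amortised:
  fixes P :: "real ^ 'n ^ 'n"
  assumes d: "0 < d" "d < 1"
    and P: "\<And>j i. 0 \<le> P $ j $ i" "\<And>i. (\<Sum>j\<in>UNIV. P $ j $ i) = d"
    and cost: "abs_cost_sequence P B s"
  shows "\<exists>w. (\<forall>j. 0 \<le> w j \<and> w j \<le> 1)
    \<and> (\<Sum>j\<in>UNIV. w j * real (out_degree P j))
        = real (num_links P) - real (links_used P s n mod num_links P)
    \<and> amortised_mass d w (residual_fluid P B s n)
        \<le> d ^ Suc (links_used P s n div num_links P) * l1_norm B"
proof (induction n)
  case 0
  have "amortised_mass d (\<lambda>_. 1) B = d * l1_norm B"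
    by (simp add: amortised_mass_def l1_norm_def sum_distrib_left)
  then show ?case
    by (intro exI[of _ "\<lambda>_. 1"]) (simp add: links_used_def num_links_def)
next
  case (Suc n)
  define F i l L where "F = residual_fluid P B s n" and "i = s (Suc n)"
    and "l = links_used P s n" and "L = num_links P"
  have next_F: "residual_fluid P B s (Suc n) = diffusion_op P i *v F"
    by (simp add: F_def i_def)
  have next_l: "links_used P s (Suc n) = l + out_degree P i"
    by (simp add: links_used_def l_def i_def)
  have out_pos: "0 < out_degree P j" for j
  proof -
    have "\<exists>k. P $ k $ j \<noteq> 0"
      using P(2)[of j] d(1) by (metis sum.neutral less_irrefl)
    then show ?thesis
      by (auto simp: out_degree_def card_gt_0_iff)
  qed
  have out_le: "out_degree P i \<le> L"
    unfolding L_def num_links_def by (intro member_le_sum) auto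
  then have L: "0 < L" using out_pos[of i] by simp
  have greedy: "\<bar>F $ j\<bar> / real (out_degree P j) \<le> \<bar>F $ i\<bar> / real (out_degree P i)" for j
    using cost[unfolded abs_cost_sequence_def, rule_format, of "Suc n"]
    by (auto simp: is_arg_max_def F_def i_def not_less)
  obtain w where w: "\<And>j. 0 \<le> w j" "\<And>j. w j \<le> 1"
    and shares: "(\<Sum>j\<in>UNIV. w j * real (out_degree P j)) = real L - real (l mod L)"
    and mass: "amortised_mass d w F \<le> d ^ Suc (l div L) * l1_norm B"
    using Suc by (auto simp: F_def l_def L_def)
  have "l mod L < L" using L by simp
  have round_div_mod: "(q * L + r) div L = q \<and> (q * L + r) mod L = r" if "r < L" for q r
    using that by simp
  show ?case
  proof (cases "l mod L + out_degree P i < L")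
    case True
    then have "real (out_degree P i) < (\<Sum>j\<in>UNIV. w j * real (out_degree P j))"
      unfolding shares by linarith
    then obtain w' where w': "\<And>j. 0 \<le> w' j" "\<And>j. w' j \<le> 1"
      "(\<Sum>j\<in>UNIV. w' j * real (out_degree P j))
        = (\<Sum>j\<in>UNIV. w j * real (out_degree P j)) - real (out_degree P i)"
      "amortised_mass d w' (diffusion_op P i *v F) \<le> amortised_mass d w F"
      using step_within_round[of d P i "\<lambda>j. real (out_degree P j)" F w] d P out_pos greedy w
      by auto
    have split: "l + out_degree P i = (l div L) * L + (l mod L + out_degree P i)"
      by simp
    have q: "(l + out_degree P i) div L = l div L"
      and m: "(l + out_degree P i) mod L = l mod L + out_degree P i"
      using round_div_mod[OF True, of "l div L"] unfolding split by blast+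
    show ?thesis
      using w' mass shares q m
      by (intro exI[of _ w']) (simp add: next_F next_l L_def del: residual_fluid.simps)
  next
    case False
    then have "(\<Sum>j\<in>UNIV. w j * real (out_degree P j)) \<le> real (out_degree P i)"
      unfolding shares by linarith
    then obtain w' where w': "\<And>j. 0 \<le> w' j" "\<And>j. w' j \<le> 1"
      "(\<Sum>j\<in>UNIV. w' j * real (out_degree P j))
        = (\<Sum>j\<in>UNIV. real (out_degree P j)) + (\<Sum>j\<in>UNIV. w j * real (out_degree P j))
            - real (out_degree P i)"
      "amortised_mass d w' (diffusion_op P i *v F) \<le> d * amortised_mass d w F"
      using step_across_rounds[of d P i "\<lambda>j. real (out_degree P j)" F w] d P out_pos greedy w
      by auto
    have split: "l + out_degree P i = Suc (l div L) * L + (l mod L + out_degree P i - L)"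
      using False div_mult_mod_eq[of l L] unfolding mult_Suc by linarith
    have rest: "l mod L + out_degree P i - L < L"
      using out_le \<open>l mod L < L\<close> by linarith
    have q: "(l + out_degree P i) div L = Suc (l div L)"
      and m: "(l + out_degree P i) mod L = l mod L + out_degree P i - L"
      using round_div_mod[OF rest, of "Suc (l div L)"] unfolding split by blast+
    have "(\<Sum>j\<in>UNIV. real (out_degree P j)) = real L"
      by (simp add: L_def num_links_def)
    then have "(\<Sum>j\<in>UNIV. w' j * real (out_degree P j))
        = real L - real ((l + out_degree P i) mod L)"
      using w'(3) shares m False by (simp add: of_nat_diff)
    moreover have "d * amortised_mass d w F \<le> d ^ Suc (Suc (l div L)) * l1_norm B"
      using mult_left_mono[OF mass, of d] d by (simp add: mult.assoc)
    ultimately show ?thesis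
      using w' q by (intro exI[of _ w']) (simp add: next_F next_l L_def del: residual_fluid.simps)
  qed
qed

lemma residual_fluid_nonneg:
  fixes P :: "real ^ 'n ^ 'n"
  assumes "\<And>j i. 0 \<le> P $ j $ i" and "\<And>i. 0 \<le> B $ i"
  shows "0 \<le> residual_fluid P B s n $ i"
  using assms by (induction n arbitrary: i) (auto simp: diffusion_op_component)

lemma abs_cost_sequence_if_nonneg:
  fixes P :: "real ^ 'n ^ 'n"
  assumes "\<And>j i. 0 \<le> P $ j $ i" and "\<And>i. 0 \<le> B $ i" and "cost_sequence P B s"
  shows "abs_cost_sequence P B s"
  using assms(3) residual_fluid_nonneg[of P B s, OF assms(1,2)]
  by (simp add: cost_sequence_def abs_cost_sequence_def)

theorem theorem14:
  fixes P P\<^sub>s :: "real ^ 'n ^ 'n" and B :: "real ^ 'n" and d :: real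
    and s :: "nat \<Rightarrow> 'n" and n :: nat
  assumes "0 < d" and "d < 1"
    and "transition_matrix P\<^sub>s"
    and "P = d *\<^sub>R P\<^sub>s"
    and "((\<forall>i. 0 \<le> B $ i) \<and> cost_sequence P B s) \<or> abs_cost_sequence P B s"
  shows "l1_norm (residual_fluid P B s n)
           \<le> d ^ (links_used P s n div num_links P) * l1_norm (residual_fluid P B s 0)"
proof -
  have P: "0 \<le> P $ j $ i" "(\<Sum>j\<in>UNIV. P $ j $ i) = d" for j i
    using assms(1,3,4) by (auto simp: transition_matrix_def simp flip: sum_distrib_left)
  have "abs_cost_sequence P B s"
    using assms(5) abs_cost_sequence_if_nonneg P(1) by blast
  from abs_cost_amortised[OF assms(1,2) P this, of n] obtain w where "\<And>j. w j \<le> 1"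
    and "amortised_mass d w (residual_fluid P B s n)
        \<le> d ^ Suc (links_used P s n div num_links P) * l1_norm B"
    by blast
  then have "d * l1_norm (residual_fluid P B s n)
      \<le> d * (d ^ (links_used P s n div num_links P) * l1_norm B)"
    using l1_norm_le_amortised_mass[of d w "residual_fluid P B s n"] assms(2)
    by (simp add: mult.assoc)
  then show ?thesis
    using assms(1) by simp
qed

end
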